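(* Let $M$ be a DFA with $n$ states such that $L = L(M)$ is not prefix-closed. Then a minimal witness $(v,w)$ to the failure of prefix-closure of $L$ satisfies $|w| \le n$. This is best possible: for every $n \ge 2$ there is a DFA with $n$ states whose language is not prefix-closed and whose minimal witness $(v,w)$ has $|w| = n$.
   Context: A word $v$ is a prefix of $w$ if $w = vx$ for some word $x$. $L$ is prefix-closed if $w \in L$ and $v$ a prefix of $w$ imply $v \in L$. A witness to the failure of prefix-closure is a pair $(v,w)$ with $w \in L$, $v \notin L$, $v$ a prefix of $w$. A witness $(v,w)$ is minimal if there is no witness $(v',w')$ with $|w'| < |w|$, or with $|w'| = |w|$ and $|v'| < |v|$. *)

theory Defs
  imports "HOL-Library.Sublist"
begin

record ('q, 'a) dfa =
  states :: "'q set"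
  alphabet :: "'a set"
  nxt :: "'q \<Rightarrow> 'a \<Rightarrow> 'q"
  init :: "'q"
  final :: "'q set"

text \<open>Automata are complete: the transition function is total on
  \<open>states M \<times> alphabet M\<close>; its values elsewhere are irrelevant.\<close>

definition is_dfa :: "('q, 'a) dfa \<Rightarrow> bool" where
  "is_dfa M \<longleftrightarrow>
     finite (states M) \<and> finite (alphabet M) \<and>
     init M \<in> states M \<and> final M \<subseteq> states M \<and>
     (\<forall>q\<in>states M. \<forall>a\<in>alphabet M. nxt M q a \<in> states M)"

definition language :: "('q, 'a) dfa \<Rightarrow> 'a list set" where
  "language M = {w \<in> lists (alphabet M). foldl (nxt M) (init M) w \<in> final M}"

definition prefix_closed :: "'a list set \<Rightarrow> bool" where
  "prefix_closed L \<longleftrightarrow> (\<forall>w v. w \<in> L \<and> prefix v w \<longrightarrow> v \<in> L)"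

definition prefix_witness :: "'a list set \<Rightarrow> 'a list \<Rightarrow> 'a list \<Rightarrow> bool" where
  "prefix_witness L v w \<longleftrightarrow> w \<in> L \<and> v \<notin> L \<and> prefix v w"

definition minimal_prefix_witness :: "'a list set \<Rightarrow> 'a list \<Rightarrow> 'a list \<Rightarrow> bool" where
  "minimal_prefix_witness L v w \<longleftrightarrow>
     prefix_witness L v w \<and>
     (\<nexists>v' w'. prefix_witness L v' w' \<and>
        (length w' < length w \<or> length w' = length w \<and> length v' < length v))"

lemma minimal_prefix_witness_exists:
  assumes "\<not> prefix_closed L"
  shows "\<exists>v w. minimal_prefix_witness L v w"
proof -
  let ?W = "\<lambda>n m. \<exists>v w. prefix_witness L v w \<and> length w = n \<and> length v = m"
  have "\<exists>n m. ?W n m"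
    using assms by (auto simp: prefix_closed_def prefix_witness_def)
  then obtain n where n: "\<exists>m. ?W n m" "\<And>n'. n' < n \<Longrightarrow> \<not> (\<exists>m. ?W n' m)"
    using exists_least_iff[of "\<lambda>n. \<exists>m. ?W n m"] by auto
  from n(1) obtain m where m: "?W n m" "\<And>m'. m' < m \<Longrightarrow> \<not> ?W n m'"
    using exists_least_iff[of "?W n"] by auto
  from m(1) obtain v w where vw: "prefix_witness L v w" "length w = n" "length v = m"
    by blast
  have "minimal_prefix_witness L v w"
    unfolding minimal_prefix_witness_def using vw n(2) m(2) by blast
  then show ?thesis by blast
qed

end

theory Submission
  imports Defs
begin

text \<open>Suppose that $xyz \in L$ has a prefix $v \notin L$, that $y$ and $z$ are nonempty, and that
  $x$ and $xy$ have the same left quotient. Then there is a shorter witness. If $v = xyv'$, take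
  $(xv', xz)$. Otherwise $v$ is a prefix of $xy$; take $(v, xy)$ if $xy \in L$, and $(x, xz)$ if not.
  So the proper prefixes of $w$ in a minimal witness $(v, w)$ have distinct left quotients, whereas
  the quotient of $L(M)$ by a word over the alphabet of $M$ is determined by the state it leads to.
  The bound is attained by the unary cycle of $n$ states whose only accepting state is the initial one.\<close>

definition left_quotient :: "'a list \<Rightarrow> 'a list set \<Rightarrow> 'a list set" where
  "left_quotient x L = {u. x @ u \<in> L}"

lemma mem_left_quotient_iff [simp]: "u \<in> left_quotient x L \<longleftrightarrow> x @ u \<in> L"
  by (simp add: left_quotient_def)

lemma not_prefix_closed_iff: "\<not> prefix_closed L \<longleftrightarrow> (\<exists>v w. prefix_witness L v w)"
  by (auto simp: prefix_closed_def prefix_witness_def)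

lemma minimal_prefix_witness_length_le:
  assumes "minimal_prefix_witness L v w" "prefix_witness L v' w'"
  shows "length w \<le> length w'"
  using assms unfolding minimal_prefix_witness_def by (meson not_le)

lemma shorter_prefix_witness:
  assumes witness: "prefix_witness L v (x @ y @ z)"
    and nonempty: "y \<noteq> []" "z \<noteq> []"
    and quotient_eq: "left_quotient x L = left_quotient (x @ y) L"
  shows "\<exists>v' w'. prefix_witness L v' w' \<and> length w' < length (x @ y @ z)"
proof -
  have cut_iff: "x @ u \<in> L \<longleftrightarrow> x @ y @ u \<in> L" for u
    using quotient_eq by (metis append_assoc mem_left_quotient_iff)
  have v_notin: "v \<notin> L" and v_prefix: "prefix v ((x @ y) @ z)"
    using witness by (simp_all add: prefix_witness_def)
  have cut_in: "x @ z \<in> L"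
    using witness cut_iff by (simp add: prefix_witness_def)
  from v_prefix consider (beyond) v' where "v = (x @ y) @ v'" "prefix v' z"
    | (accepted) "prefix v (x @ y)" "x @ y \<in> L"
    | (rejected) "x @ y \<notin> L"
    unfolding prefix_append by blast
  then show ?thesis
  proof cases
    case beyond
    then have "prefix_witness L (x @ v') (x @ z)"
      using cut_in v_notin cut_iff by (simp add: prefix_witness_def)
    then show ?thesis using nonempty by fastforce
  next
    case accepted
    then have "prefix_witness L v (x @ y)"
      using v_notin by (simp add: prefix_witness_def)
    then show ?thesis using nonempty by fastforce
  next
    case rejected
    then have "prefix_witness L x (x @ z)"
      using cut_in cut_iff[of "[]"] by (simp add: prefix_witness_def)
    then show ?thesis using nonempty by fastforce
  qed
qed

lemma inj_on_left_quotient_take: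
  assumes minimal: "minimal_prefix_witness L v w"
  shows "inj_on (\<lambda>i. left_quotient (take i w) L) {..<length w}"
proof (rule linorder_inj_onI)
  fix i j
  assume "i < j" and "j \<in> {..<length w}"
  define x y z where "x = take i w" and "y = drop i (take j w)" and "z = drop j w"
  have take_j: "take j w = x @ y"
    using \<open>i < j\<close> append_take_drop_id[of i "take j w"] by (simp add: x_def y_def)
  then have w: "w = x @ y @ z"
    by (metis append_assoc append_take_drop_id z_def)
  have nonempty: "y \<noteq> []" "z \<noteq> []"
    using \<open>i < j\<close> \<open>j \<in> {..<length w}\<close> by (simp_all add: y_def z_def)
  have "prefix_witness L v (x @ y @ z)"
    using minimal by (simp add: minimal_prefix_witness_def w)
  then have "left_quotient x L \<noteq> left_quotient (x @ y) L"
    using shorter_prefix_witness nonempty minimal_prefix_witness_length_le[OF minimal]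
    by (metis leD w)
  then show "left_quotient (take i w) L \<noteq> left_quotient (take j w) L"
    by (simp add: take_j x_def)
qed auto

lemma foldl_nxt_in_states:
  assumes "is_dfa M" "q \<in> states M" "w \<in> lists (alphabet M)"
  shows "foldl (nxt M) q w \<in> states M"
  using assms(2,3) by (induction w arbitrary: q) (use assms(1) in \<open>auto simp: is_dfa_def\<close>)

lemma left_quotient_language:
  assumes "x \<in> lists (alphabet M)"
  shows "left_quotient x (language M) = language (M\<lparr>init := foldl (nxt M) (init M) x\<rparr>)"
  using assms by (auto simp: language_def)

lemma minimal_prefix_witness_length_le_card_states:
  assumes M: "is_dfa M" and minimal: "minimal_prefix_witness (language M) v w"
  shows "length w \<le> card (states M)"
proof -
  let ?quotient = "\<lambda>i. left_quotient (take i w) (language M)"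
  let ?from = "\<lambda>q. language (M\<lparr>init := q\<rparr>)"
  have w: "w \<in> lists (alphabet M)"
    using minimal by (simp add: minimal_prefix_witness_def prefix_witness_def language_def)
  have init: "init M \<in> states M" and finite: "finite (states M)"
    using M by (simp_all add: is_dfa_def)
  have "?quotient i \<in> ?from ` states M" for i
  proof -
    have "take i w \<in> lists (alphabet M)"
      using w set_take_subset[of i w] by auto
    then show ?thesis
      using foldl_nxt_in_states[OF M init] by (simp add: left_quotient_language)
  qed
  then have "card {..<length w} \<le> card (?from ` states M)"
    using finite by (intro card_inj_on_le[OF inj_on_left_quotient_take[OF minimal]]) auto
  also have "\<dots> \<le> card (states M)"
    using finite by (rule card_image_le)
  finally show ?thesis by simp
qed

definition cycle_dfa :: "'a \<Rightarrow> nat \<Rightarrow> (nat, 'a) dfa" where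
  "cycle_dfa a n =
     \<lparr>states = {..<n}, alphabet = {a}, nxt = (\<lambda>q _. Suc q mod n), init = 0, final = {0}\<rparr>"

lemma card_states_cycle_dfa [simp]: "card (states (cycle_dfa a n)) = n"
  by (simp add: cycle_dfa_def)

lemma is_dfa_cycle_dfa: "n > 0 \<Longrightarrow> is_dfa (cycle_dfa a n)"
  by (simp add: is_dfa_def cycle_dfa_def)

lemma foldl_Suc_mod: "foldl (\<lambda>q _. Suc q mod n) (q mod n) w = (q + length w) mod n"
proof (induction w arbitrary: q)
  case (Cons a w)
  then show ?case using Cons.IH[of "Suc q"] by (simp add: mod_Suc_eq)
qed simp

lemma language_cycle_dfa: "language (cycle_dfa a n) = {w \<in> lists {a}. n dvd length w}"
  by (auto simp: language_def cycle_dfa_def foldl_Suc_mod[of n 0, simplified])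

lemma prefix_witness_cycle_dfa:
  assumes "n \<ge> 2"
  shows "prefix_witness (language (cycle_dfa a n)) [a] (replicate n a)"
  using assms by (cases n) (auto simp: prefix_witness_def language_cycle_dfa)

lemma prefix_witness_cycle_dfa_length_ge:
  assumes "prefix_witness (language (cycle_dfa a n)) v w"
  shows "n \<le> length w"
proof -
  have "w \<noteq> []"
    using assms by (auto simp: prefix_witness_def)
  moreover have "n dvd length w"
    using assms by (simp add: prefix_witness_def language_cycle_dfa)
  ultimately show ?thesis by (auto intro: dvd_imp_le)
qed

lemma minimal_prefix_witness_cycle_dfa_length:
  assumes "n \<ge> 2" and minimal: "minimal_prefix_witness (language (cycle_dfa a n)) v w"
  shows "length w = n"
proof (rule antisym)
  show "length w \<le> n"
    using minimal_prefix_witness_length_le[OF minimal prefix_witness_cycle_dfa[OF \<open>n \<ge> 2\<close>]]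
    by simp
  show "n \<le> length w"
    using minimal prefix_witness_cycle_dfa_length_ge[of a n v w]
    by (simp add: minimal_prefix_witness_def)
qed

theorem theorem11:
  shows "(\<forall>(M :: ('q, 'a) dfa) n.
            is_dfa M \<and> card (states M) = n \<and> \<not> prefix_closed (language M) \<longrightarrow>
            (\<forall>v w. minimal_prefix_witness (language M) v w \<longrightarrow> length w \<le> n))
       \<and> (\<forall>n\<ge>2. \<exists>M :: (nat, nat) dfa.
            is_dfa M \<and> card (states M) = n \<and> \<not> prefix_closed (language M) \<and>
            (\<exists>v w. minimal_prefix_witness (language M) v w) \<and>
            (\<forall>v w. minimal_prefix_witness (language M) v w \<longrightarrow> length w = n))"
proof (intro conjI allI impI)
  fix M :: "('q, 'a) dfa" and n v w
  assume "is_dfa M \<and> card (states M) = n \<and> \<not> prefix_closed (language M)"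
    and "minimal_prefix_witness (language M) v w"
  then show "length w \<le> n"
    using minimal_prefix_witness_length_le_card_states by blast
next
  fix n :: nat
  assume n: "n \<ge> 2"
  let ?M = "cycle_dfa (0 :: nat) n"
  have not_closed: "\<not> prefix_closed (language ?M)"
    unfolding not_prefix_closed_iff using prefix_witness_cycle_dfa[OF n] by (intro exI)
  show "\<exists>M :: (nat, nat) dfa.
            is_dfa M \<and> card (states M) = n \<and> \<not> prefix_closed (language M) \<and>
            (\<exists>v w. minimal_prefix_witness (language M) v w) \<and>
            (\<forall>v w. minimal_prefix_witness (language M) v w \<longrightarrow> length w = n)"
    using n is_dfa_cycle_dfa[of n 0] card_states_cycle_dfa[of 0 n] not_closed
      minimal_prefix_witness_exists[OF not_closed] minimal_prefix_witness_cycle_dfa_length[OF n]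
    by (intro exI[of _ ?M]) auto
qed

end
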